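(* Let the functions $H_+$, $H_-$ and the quantities $K_+(d,\alpha,\kappa)=\max_{t\in(0,1)}H_+(t)$ and $K_-(d,\alpha,\kappa,\eta)=\min_{t\in(0,1)}H_-(t;d,\alpha,\kappa,\eta)$ be as defined in the context. The following hold: (1) For fixed $d\in\mathbb N$ and $\alpha\in(0,2)$ there exists $\kappa^*=\kappa^*(d,\alpha)$ with $\frac{d-1}2<\kappa^*<\frac d2$ such that $K_+(d,\alpha,\kappa)>0$ for every $\kappa\in\left(\kappa^*,\frac d2\right)$. (2) For fixed $d\in\mathbb N$, $\eta>0$ and $\kappa\in\left(0,\frac d2\right)$ there exists $\alpha^*\in(0,2)$ such that $K_-(d,\alpha,\kappa,\eta)<0$ for every $\alpha\in(0,\alpha^* )$.
   Context: For $d\in\mathbb N$, $\alpha\in(0,2)$, $\kappa\in\left(\frac{d-1}2,\frac d2\right)$ and $t\in(0,1)$, $$\begin{aligned}H_+(t)={}&\frac{(1-t)^{d-2\kappa}(1+t)^{2\kappa+\alpha}(2\kappa+\alpha+1)^{2\kappa+\alpha}+(2\kappa+\alpha)^{2\kappa+\alpha}(2-t)^{d+\alpha}(d-2\kappa)}{(2-t)^{d+\alpha}(1+t)^{2\kappa+\alpha}(d-2\kappa)(2\kappa+\alpha+1)^{2\kappa+\alpha}}\\&-\frac{\alpha(1-t)^{d+2\kappa+2}(2-\alpha)+dt^d(2-\alpha)(1-t)^{2\kappa+2}+2\kappa(2\kappa+1)d^3\alpha t^{d+2}}{d\alpha(2-\alpha)t^{d+\alpha}(1-t)^{2\kappa+2}}.\end{aligned}$$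 For $d\in\mathbb N$, $\alpha\in(0,2)$, $\kappa\in\left(0,\frac d2\right)$, $\eta>0$ and $t\in(0,1)$, $$\begin{aligned}H_-(t;d,\alpha,\kappa,\eta)={}&\frac1{(d-2\kappa)t^{d+\alpha}}+\frac{2\kappa(2\kappa+1)d^2t^{2-\alpha}}{(2-\alpha)(1-t)^{2\kappa+2}}\\&+\left(\frac{2\kappa d+(d+\eta)\alpha}{(d+\eta-2\kappa)\eta}\right)^{\frac{2\kappa}{d+\eta}}\frac{d+\eta-2\kappa}{2d\kappa+(d+\eta)\alpha}\,\frac1{t^{\frac{2d\kappa+(d+\eta)\alpha}{d+\eta}}}-\left(\frac1{\alpha(1+t)^\alpha}+\frac{(1-t)^d}{d(2-t)^{d+\alpha}}\right).\end{aligned}$$ *)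

theory Defs
  imports Complex_Main
begin

definition H_plus :: "nat \<Rightarrow> real \<Rightarrow> real \<Rightarrow> real \<Rightarrow> real" where
  "H_plus d \<alpha> \<kappa> t =
     ((1 - t) powr (real d - 2*\<kappa>) * (1 + t) powr (2*\<kappa> + \<alpha>) * (2*\<kappa> + \<alpha> + 1) powr (2*\<kappa> + \<alpha>)
        + (2*\<kappa> + \<alpha>) powr (2*\<kappa> + \<alpha>) * (2 - t) powr (real d + \<alpha>) * (real d - 2*\<kappa>))
     / ((2 - t) powr (real d + \<alpha>) * (1 + t) powr (2*\<kappa> + \<alpha>) * (real d - 2*\<kappa>)
        * (2*\<kappa> + \<alpha> + 1) powr (2*\<kappa> + \<alpha>))
     - (\<alpha> * (1 - t) powr (real d + 2*\<kappa> + 2) * (2 - \<alpha>)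
        + real d * t ^ d * (2 - \<alpha>) * (1 - t) powr (2*\<kappa> + 2)
        + 2*\<kappa> * (2*\<kappa> + 1) * real d ^ 3 * \<alpha> * t ^ (d + 2))
     / (real d * \<alpha> * (2 - \<alpha>) * t powr (real d + \<alpha>) * (1 - t) powr (2*\<kappa> + 2))"

definition H_minus :: "real \<Rightarrow> nat \<Rightarrow> real \<Rightarrow> real \<Rightarrow> real \<Rightarrow> real" where
  "H_minus t d \<alpha> \<kappa> \<eta> =
     1 / ((real d - 2*\<kappa>) * t powr (real d + \<alpha>))
     + (2*\<kappa> * (2*\<kappa> + 1) * real d ^ 2 * t powr (2 - \<alpha>)) / ((2 - \<alpha>) * (1 - t) powr (2*\<kappa> + 2))
     + ((2*\<kappa> * real d + (real d + \<eta>) * \<alpha>) / ((real d + \<eta> - 2*\<kappa>) * \<eta>)) powr (2*\<kappa> / (real d + \<eta>))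
       * ((real d + \<eta> - 2*\<kappa>) / (2 * real d * \<kappa> + (real d + \<eta>) * \<alpha>))
       * (1 / t powr ((2 * real d * \<kappa> + (real d + \<eta>) * \<alpha>) / (real d + \<eta>)))
     - (1 / (\<alpha> * (1 + t) powr \<alpha>) + (1 - t) ^ d / (real d * (2 - t) powr (real d + \<alpha>)))"

text \<open>
  \<open>GREATEST\<close> and \<open>LEAST\<close> denote an attained maximum and minimum (unlike \<open>Sup\<close> and \<open>Inf\<close>).
  For \<open>d \<ge> 1\<close> and parameters in the admissible ranges both exist: \<open>H_plus\<close> tends to minus infinity,
  and \<open>H_minus\<close> to plus infinity, at both ends of the open interval, where both are continuous.
\<close>

definition K_plus :: "nat \<Rightarrow> real \<Rightarrow> real \<Rightarrow> real" where
  "K_plus d \<alpha> \<kappa> = (GREATEST y. y \<in> (\<lambda>t. H_plus d \<alpha> \<kappa> t) ` {0<..<1})"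

definition K_minus :: "nat \<Rightarrow> real \<Rightarrow> real \<Rightarrow> real \<Rightarrow> real" where
  "K_minus d \<alpha> \<kappa> \<eta> = (LEAST y. y \<in> (\<lambda>t. H_minus t d \<alpha> \<kappa> \<eta>) ` {0<..<1})"

end

theory Submission
  imports Defs
begin

text \<open>
  Both parts come from one singular summand. At a fixed interior point, say \<open>t = 1/2\<close>, every
  summand of \<open>H_plus\<close> has a finite limit as \<open>\<kappa>\<close> increases to \<open>d/2\<close>, except one that contains the
  factor \<open>1 / (d - 2\<kappa>)\<close> and tends to infinity; and every summand of \<open>H_minus\<close> has a finite limit
  as \<open>\<alpha>\<close> decreases to \<open>0\<close>, except \<open>- 1 / (\<alpha> (1 + t) powr \<alpha>)\<close>, which tends to minus infinity.
  So close enough to the critical parameter value already \<open>H_plus d \<alpha> \<kappa> (1/2) > 0\<close>, respectively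
  \<open>H_minus (1/2) d \<alpha> \<kappa> \<eta> < 0\<close> (\<open>H_plus_at_top_critical\<close>, \<open>H_minus_at_bot_critical\<close>).

  To compare these values with the extrema, the extrema have to be attained: \<open>GREATEST\<close> and
  \<open>LEAST\<close> carry no information otherwise. For admissible parameters \<open>- H_plus\<close> and \<open>H_minus\<close> are
  continuous in \<open>t\<close> and tend to infinity at both ends of the unit interval, because of a negative
  power of \<open>t\<close> at \<open>0\<close> and of \<open>(1 - t) powr - (2\<kappa> + 2)\<close> at \<open>1\<close>; such functions attain their
  minimum (\<open>coercive_attains_inf\<close>).
\<close>

section \<open>Coercive functions on the open unit interval\<close>

text \<open>
  Near the two ends the function exceeds its value at \<open>1/2\<close>, so its minimum over the
  remaining compact interval is global.
\<close>

lemma coercive_attains_inf: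
  fixes f :: "real \<Rightarrow> real"
  assumes cont: "continuous_on {0<..<1} f"
    and at0: "filterlim f at_top (at_right 0)"
    and at1: "filterlim f at_top (at_left 1)"
  obtains s where "s \<in> {0<..<1}" and "\<And>t. t \<in> {0<..<1} \<Longrightarrow> f s \<le> f t"
proof -
  have "\<forall>\<^sub>F t in at_right 0. f (1/2) < f t"
    using at0 by (simp add: filterlim_at_top_dense)
  then obtain a where a: "a > 0" "\<And>t. 0 < t \<Longrightarrow> t < a \<Longrightarrow> f (1/2) < f t"
    by (auto simp: eventually_at_right_field)
  have "\<forall>\<^sub>F t in at_left 1. f (1/2) < f t"
    using at1 by (simp add: filterlim_at_top_dense)
  then obtain b where b: "b < 1" "\<And>t. b < t \<Longrightarrow> t < 1 \<Longrightarrow> f (1/2) < f t"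
    by (auto simp: eventually_at_left_field)
  have mid: "a \<le> 1/2" "1/2 \<le> b"
    using a(2)[of "1/2"] b(2)[of "1/2"] by force+
  have "continuous_on {a..b} f"
    by (rule continuous_on_subset[OF cont]) (use a b in auto)
  then obtain s where s: "s \<in> {a..b}" "\<And>t. t \<in> {a..b} \<Longrightarrow> f s \<le> f t"
    using continuous_attains_inf[of "{a..b}" f] mid by auto
  show thesis
  proof
    show "s \<in> {0<..<1}" using s a b by auto
    fix t :: real assume t: "t \<in> {0<..<1}"
    have half: "f s \<le> f (1/2)" using s mid by auto
    consider "t < a" | "t \<in> {a..b}" | "b < t" by fastforce
    then show "f s \<le> f t"
      using a(2)[of t] b(2)[of t] s(2)[of t] half t by cases auto
  qed
qed

lemma Least_coercive_le:
  fixes f :: "real \<Rightarrow> real"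
  assumes "continuous_on {0<..<1} f"
    and "filterlim f at_top (at_right 0)"
    and "filterlim f at_top (at_left 1)"
    and "t \<in> {0<..<1}"
  shows "(LEAST y. y \<in> f ` {0<..<1}) \<le> f t"
proof -
  obtain s where s: "s \<in> {0<..<1}" "\<And>u. u \<in> {0<..<1} \<Longrightarrow> f s \<le> f u"
    using coercive_attains_inf[OF assms(1-3)] by blast
  have "(LEAST y. y \<in> f ` {0<..<1}) = f s"
    by (rule Least_equality) (use s in auto)
  then show ?thesis using s assms(4) by simp
qed

lemma Greatest_coercive_ge:
  fixes f :: "real \<Rightarrow> real"
  assumes "continuous_on {0<..<1} f"
    and "filterlim (\<lambda>t. - f t) at_top (at_right 0)"
    and "filterlim (\<lambda>t. - f t) at_top (at_left 1)"
    and "t \<in> {0<..<1}"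
  shows "f t \<le> (GREATEST y. y \<in> f ` {0<..<1})"
proof -
  have "continuous_on {0<..<1} (\<lambda>t. - f t)"
    using assms(1) by (rule continuous_on_minus)
  then obtain s where s: "s \<in> {0<..<1}" "\<And>u. u \<in> {0<..<1} \<Longrightarrow> - f s \<le> - f u"
    using coercive_attains_inf[OF _ assms(2,3)] by blast
  have "(GREATEST y. y \<in> f ` {0<..<1}) = f s"
    by (rule Greatest_equality) (use s in auto)
  then show ?thesis using s assms(4) by simp
qed

lemma eventually_unit_interval:
  fixes P :: "real \<Rightarrow> bool"
  assumes "\<And>t. 0 < t \<Longrightarrow> t < 1 \<Longrightarrow> P t"
  shows "eventually P (at_right 0)" "eventually P (at_left 1)"
  using assms by (auto simp: eventually_at_right_field eventually_at_left_field
      intro: exI[of _ 1] exI[of _ 0])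

lemma filterlim_inverse_powr_at_right_0:
  fixes p :: real
  assumes "p > 0"
  shows "filterlim (\<lambda>t. 1 / t powr p) at_top (at_right 0)"
proof -
  have "((\<lambda>t::real. t powr p) \<longlongrightarrow> 0) (at_right 0)"
    by (rule tendsto_zero_powrI[where b = p])
       (use assms in \<open>auto intro!: tendsto_intros eventually_unit_interval\<close>)
  moreover have "\<forall>\<^sub>F t in at_right 0. (0::real) < t powr p"
    by (rule eventually_unit_interval) auto
  ultimately show ?thesis
    unfolding inverse_eq_divide[symmetric] by (rule filterlim_inverse_at_top)
qed

lemma filterlim_inverse_powr_at_left_1:
  fixes p :: real
  assumes "p > 0"
  shows "filterlim (\<lambda>t. 1 / (1 - t) powr p) at_top (at_left 1)"
proof -
  have "((\<lambda>t::real. (1 - t) powr p) \<longlongrightarrow> 0) (at_left 1)"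
    by (rule tendsto_zero_powrI[where b = p])
       (use assms in \<open>auto intro!: tendsto_eq_intros eventually_unit_interval\<close>)
  moreover have "\<forall>\<^sub>F t in at_left 1. (0::real) < (1 - t) powr p"
    by (rule eventually_unit_interval) auto
  ultimately show ?thesis
    unfolding inverse_eq_divide[symmetric] by (rule filterlim_inverse_at_top)
qed

section \<open>The function \<open>H_plus\<close>\<close>

text \<open>
  Cancelling common factors separates the summand that is singular at \<open>\<kappa> = d/2\<close> from
  those that are singular at \<open>t = 0\<close> and at \<open>t = 1\<close>.
\<close>

lemma H_plus_split:
  assumes "d \<ge> 1" "0 < \<alpha>" "\<alpha> < 2" "0 < \<kappa>" "\<kappa> < real d / 2" "0 < t" "t < 1"
  shows "H_plus d \<alpha> \<kappa> t =
      (1 - t) powr (real d - 2*\<kappa>) / (2 - t) powr (real d + \<alpha>) * (1 / (real d - 2*\<kappa>))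
    + (2*\<kappa> + \<alpha>) powr (2*\<kappa> + \<alpha>) / ((2*\<kappa> + \<alpha> + 1) powr (2*\<kappa> + \<alpha>) * (1 + t) powr (2*\<kappa> + \<alpha>))
    - ((1 - t)^d / (real d * t powr (real d + \<alpha>)) + 1 / \<alpha> * (1 / t powr \<alpha>)
       + 2*\<kappa> * (2*\<kappa> + 1) * (real d)^2 * t^2 / ((2 - \<alpha>) * t powr \<alpha>) * (1 / (1 - t) powr (2*\<kappa> + 2)))"
proof -
  have e: "(1 - t) powr (real d + 2*\<kappa> + 2) = (1 - t)^d * (1 - t) powr (2*\<kappa> + 2)"
    "t powr (real d + \<alpha>) = t^d * t powr \<alpha>"
    using assms by (simp_all add: powr_add powr_realpow algebra_simps)
  have cancel1: "(P * U * V + W * Q * s) / (Q * U * s * V) = P / Q * (1 / s) + W / (V * U)"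
    if "Q \<noteq> 0" "U \<noteq> 0" "s \<noteq> 0" "V \<noteq> 0" for P Q U V W s :: real
    using that by (simp add: field_simps)
  have cancel2: "(a * (X * Y) * b + n * T * b * Y + k * n^3 * a * (T * t^2)) / (n * a * b * (T * Z) * Y)
      = X / (n * (T * Z)) + 1 / a * (1 / Z) + k * n^2 * t^2 / (b * Z) * (1 / Y)"
    if "a \<noteq> 0" "b \<noteq> 0" "n \<noteq> 0" "T \<noteq> 0" "Z \<noteq> 0" "Y \<noteq> 0" for a b n k T X Y Z :: real
    using that by (simp add: field_simps power2_eq_square power3_eq_cube)
  show ?thesis
    unfolding H_plus_def e power_add
    by (subst cancel1, use assms in simp, use assms in simp, use assms in simp, use assms in simp)
       (subst cancel2; use assms in simp)
qed

lemma continuous_on_H_plus: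
  assumes "d \<ge> 1" "0 < \<alpha>" "\<alpha> < 2" "0 < \<kappa>" "\<kappa> < real d / 2"
  shows "continuous_on {0<..<1} (H_plus d \<alpha> \<kappa>)"
  unfolding H_plus_def
  by (intro continuous_intros) (use assms in auto)

text \<open>
  All singular summands of \<open>- H_plus\<close> are nonnegative, so at each end it suffices to keep one
  divergent summand next to the part \<open>A\<close>, which has a finite limit at both ends.
\<close>

lemma H_plus_at_ends:
  assumes par: "d \<ge> 1" "0 < \<alpha>" "\<alpha> < 2" "0 < \<kappa>" "\<kappa> < real d / 2"
  shows "filterlim (\<lambda>t. - H_plus d \<alpha> \<kappa> t) at_top (at_right 0)"
    and "filterlim (\<lambda>t. - H_plus d \<alpha> \<kappa> t) at_top (at_left 1)"
proof -
  define A where "A t = (1 - t) powr (real d - 2*\<kappa>) / (2 - t) powr (real d + \<alpha>) * (1 / (real d - 2*\<kappa>))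
    + (2*\<kappa> + \<alpha>) powr (2*\<kappa> + \<alpha>) / ((2*\<kappa> + \<alpha> + 1) powr (2*\<kappa> + \<alpha>) * (1 + t) powr (2*\<kappa> + \<alpha>))" for t
  define B1 where "B1 t = (1 - t)^d / (real d * t powr (real d + \<alpha>))" for t
  define B2 where "B2 t = 1 / \<alpha> * (1 / t powr \<alpha>)" for t
  define c where "c t = 2*\<kappa> * (2*\<kappa> + 1) * (real d)^2 * t^2 / ((2 - \<alpha>) * t powr \<alpha>)" for t
  define B3 where "B3 t = c t * (1 / (1 - t) powr (2*\<kappa> + 2))" for t
  have split: "- H_plus d \<alpha> \<kappa> t = - A t + (B1 t + B2 t + B3 t)" if "0 < t" "t < 1" for t
    using H_plus_split[OF par that] by (simp add: A_def B1_def B2_def B3_def c_def)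
  have nonneg: "B1 t \<ge> 0" "B2 t \<ge> 0" "B3 t \<ge> 0" if "0 < t" "t < 1" for t
    using par that by (auto simp: B1_def B2_def B3_def c_def)
  have A0: "((\<lambda>t. - A t) \<longlongrightarrow> - A 0) (at_right 0)"
    unfolding A_def by (intro tendsto_intros) (use par in auto)
  have B2: "filterlim B2 at_top (at_right 0)"
    unfolding B2_def
    by (rule filterlim_tendsto_pos_mult_at_top[OF tendsto_const _ filterlim_inverse_powr_at_right_0])
       (use par in auto)
  show "filterlim (\<lambda>t. - H_plus d \<alpha> \<kappa> t) at_top (at_right 0)"
  proof (rule filterlim_at_top_mono[OF filterlim_tendsto_add_at_top[OF A0 B2]])
    show "\<forall>\<^sub>F t in at_right 0. - A t + B2 t \<le> - H_plus d \<alpha> \<kappa> t"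
    proof (rule eventually_unit_interval)
      fix t :: real assume "0 < t" "t < 1"
      then show "- A t + B2 t \<le> - H_plus d \<alpha> \<kappa> t"
        using split[of t] nonneg[of t] by linarith
    qed
  qed
  have A1a: "((\<lambda>t. (1 - t) powr (real d - 2*\<kappa>)) \<longlongrightarrow> 0) (at_left 1)"
    by (rule tendsto_zero_powrI[where b = "real d - 2*\<kappa>"])
       (use par in \<open>auto intro!: tendsto_eq_intros eventually_unit_interval\<close>)
  have A1: "((\<lambda>t. - A t) \<longlongrightarrow> - (0 / (2 - 1) powr (real d + \<alpha>) * (1 / (real d - 2*\<kappa>))
    + (2*\<kappa> + \<alpha>) powr (2*\<kappa> + \<alpha>) / ((2*\<kappa> + \<alpha> + 1) powr (2*\<kappa> + \<alpha>) * (1 + 1) powr (2*\<kappa> + \<alpha>)))) (at_left 1)"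
    unfolding A_def by (intro tendsto_intros A1a) (use par in auto)
  have c1: "(c \<longlongrightarrow> c 1) (at_left 1)"
    unfolding c_def by (intro tendsto_intros) (use par in auto)
  have "filterlim B3 at_top (at_left 1)"
    unfolding B3_def
    by (rule filterlim_tendsto_pos_mult_at_top[OF c1 _ filterlim_inverse_powr_at_left_1])
       (use par in \<open>auto simp: c_def\<close>)
  note B3 = filterlim_tendsto_add_at_top[OF A1 this]
  show "filterlim (\<lambda>t. - H_plus d \<alpha> \<kappa> t) at_top (at_left 1)"
  proof (rule filterlim_at_top_mono[OF B3])
    show "\<forall>\<^sub>F t in at_left 1. - A t + B3 t \<le> - H_plus d \<alpha> \<kappa> t"
    proof (rule eventually_unit_interval)
      fix t :: real assume "0 < t" "t < 1"
      then show "- A t + B3 t \<le> - H_plus d \<alpha> \<kappa> t"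
        using split[of t] nonneg[of t] by linarith
    qed
  qed
qed

lemma H_plus_le_K_plus:
  assumes "d \<ge> 1" "0 < \<alpha>" "\<alpha> < 2" "0 < \<kappa>" "\<kappa> < real d / 2" "t \<in> {0<..<1}"
  shows "H_plus d \<alpha> \<kappa> t \<le> K_plus d \<alpha> \<kappa>"
  unfolding K_plus_def using assms
  by (intro Greatest_coercive_ge continuous_on_H_plus H_plus_at_ends)

text \<open>
  The factor \<open>(1 - t) powr (d - 2\<kappa>)\<close> in front of \<open>1 / (d - 2\<kappa>)\<close> tends to \<open>1\<close>, and all other
  summands of the decomposition are continuous in \<open>\<kappa>\<close> at \<open>d/2\<close>.
\<close>

lemma H_plus_at_top_critical:
  assumes "d \<ge> 1" "0 < \<alpha>" "\<alpha> < 2" "0 < t" "t < 1"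
  shows "filterlim (\<lambda>\<kappa>. H_plus d \<alpha> \<kappa> t) at_top (at_left (real d / 2))"
proof -
  define P where "P \<kappa> = (1 - t) powr (real d - 2*\<kappa>) / (2 - t) powr (real d + \<alpha>)" for \<kappa>
  define R where "R \<kappa> = (2*\<kappa> + \<alpha>) powr (2*\<kappa> + \<alpha>) / ((2*\<kappa> + \<alpha> + 1) powr (2*\<kappa> + \<alpha>) * (1 + t) powr (2*\<kappa> + \<alpha>))
    - ((1 - t)^d / (real d * t powr (real d + \<alpha>)) + 1 / \<alpha> * (1 / t powr \<alpha>)
       + 2*\<kappa> * (2*\<kappa> + 1) * (real d)^2 * t^2 / ((2 - \<alpha>) * t powr \<alpha>) * (1 / (1 - t) powr (2*\<kappa> + 2)))" for \<kappa>
  have R: "(R \<longlongrightarrow> R (real d / 2)) (at_left (real d / 2))"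
    unfolding R_def by (intro tendsto_intros) (use assms in auto)
  have P: "(P \<longlongrightarrow> P (real d / 2)) (at_left (real d / 2))"
    unfolding P_def by (intro tendsto_intros) (use assms in auto)
  have "((\<lambda>\<kappa>. real d - 2*\<kappa>) \<longlongrightarrow> 0) (at_left (real d / 2))"
    by (auto intro!: tendsto_eq_intros)
  moreover have "\<forall>\<^sub>F \<kappa> in at_left (real d / 2). 0 < real d - 2*\<kappa>"
    by (rule eventually_mono[OF eventually_at_left_real[of 0]]) (use assms in auto)
  ultimately have "filterlim (\<lambda>\<kappa>. 1 / (real d - 2*\<kappa>)) at_top (at_left (real d / 2))"
    unfolding inverse_eq_divide[symmetric] by (rule filterlim_inverse_at_top)
  then have "filterlim (\<lambda>\<kappa>. P \<kappa> * (1 / (real d - 2*\<kappa>))) at_top (at_left (real d / 2))"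
    by (rule filterlim_tendsto_pos_mult_at_top[OF P, rotated]) (use assms in \<open>auto simp: P_def\<close>)
  note lim = filterlim_tendsto_add_at_top[OF R this]
  show ?thesis
  proof (rule filterlim_at_top_mono[OF lim])
    have "\<forall>\<^sub>F \<kappa> in at_left (real d / 2). \<kappa> \<in> {0<..<real d / 2}"
      by (rule eventually_at_left_real) (use assms in auto)
    then show "\<forall>\<^sub>F \<kappa> in at_left (real d / 2).
        R \<kappa> + P \<kappa> * (1 / (real d - 2*\<kappa>)) \<le> H_plus d \<alpha> \<kappa> t"
    proof eventually_elim
      case (elim \<kappa>)
      then show ?case
        using H_plus_split[of d \<alpha> \<kappa> t] assms by (simp add: P_def R_def)
    qed
  qed
qed

section \<open>The function \<open>H_minus\<close>\<close>

lemma continuous_on_H_minus: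
  assumes "d \<ge> 1" "0 < \<alpha>" "\<alpha> < 2" "0 < \<kappa>" "\<kappa> < real d / 2" "0 < \<eta>"
  shows "continuous_on {0<..<1} (\<lambda>t. H_minus t d \<alpha> \<kappa> \<eta>)"
proof -
  have "2 * real d * \<kappa> + (real d + \<eta>) * \<alpha> > 0"
    using assms by (intro add_pos_pos mult_pos_pos) auto
  then show ?thesis
    unfolding H_minus_def
    by (intro continuous_intros) (use assms in auto)
qed

lemma H_minus_at_ends:
  assumes par: "d \<ge> 1" "0 < \<alpha>" "\<alpha> < 2" "0 < \<kappa>" "\<kappa> < real d / 2" "0 < \<eta>"
  shows "filterlim (\<lambda>t. H_minus t d \<alpha> \<kappa> \<eta>) at_top (at_right 0)"
    and "filterlim (\<lambda>t. H_minus t d \<alpha> \<kappa> \<eta>) at_top (at_left 1)"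
proof -
  define A where "A t = 1 / (\<alpha> * (1 + t) powr \<alpha>) + (1 - t) ^ d / (real d * (2 - t) powr (real d + \<alpha>))" for t
  define B1 where "B1 t = 1 / (real d - 2*\<kappa>) * (1 / t powr (real d + \<alpha>))" for t
  define c where "c t = 2*\<kappa> * (2*\<kappa> + 1) * real d ^ 2 * t powr (2 - \<alpha>) / (2 - \<alpha>)" for t
  define B2 where "B2 t = c t * (1 / (1 - t) powr (2*\<kappa> + 2))" for t
  define B3 where "B3 t = ((2*\<kappa> * real d + (real d + \<eta>) * \<alpha>) / ((real d + \<eta> - 2*\<kappa>) * \<eta>)) powr (2*\<kappa> / (real d + \<eta>))
       * ((real d + \<eta> - 2*\<kappa>) / (2 * real d * \<kappa> + (real d + \<eta>) * \<alpha>))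
       * (1 / t powr ((2 * real d * \<kappa> + (real d + \<eta>) * \<alpha>) / (real d + \<eta>)))" for t
  have split: "H_minus t d \<alpha> \<kappa> \<eta> = - A t + (B1 t + B2 t + B3 t)" for t
    by (simp add: H_minus_def A_def B1_def B2_def B3_def c_def)
  have nonneg: "B1 t \<ge> 0" "B2 t \<ge> 0" "B3 t \<ge> 0" for t
    using par by (auto simp: B1_def B2_def B3_def c_def)
  have A0: "((\<lambda>t. - A t) \<longlongrightarrow> - A 0) (at_right 0)"
    unfolding A_def by (intro tendsto_intros) (use par in auto)
  have A1: "((\<lambda>t. - A t) \<longlongrightarrow> - A 1) (at_left 1)"
    unfolding A_def by (intro tendsto_intros) (use par in auto)
  have B1: "filterlim B1 at_top (at_right 0)"
    unfolding B1_def
    by (rule filterlim_tendsto_pos_mult_at_top[OF tendsto_const _ filterlim_inverse_powr_at_right_0])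
       (use par in auto)
  show "filterlim (\<lambda>t. H_minus t d \<alpha> \<kappa> \<eta>) at_top (at_right 0)"
    by (rule filterlim_at_top_mono[OF filterlim_tendsto_add_at_top[OF A0 B1]])
       (use split nonneg in \<open>simp add: add_increasing2\<close>)
  have c1: "(c \<longlongrightarrow> c 1) (at_left 1)"
    unfolding c_def by (intro tendsto_intros) (use par in auto)
  have B2: "filterlim B2 at_top (at_left 1)"
    unfolding B2_def
    by (rule filterlim_tendsto_pos_mult_at_top[OF c1 _ filterlim_inverse_powr_at_left_1])
       (use par in \<open>auto simp: c_def\<close>)
  show "filterlim (\<lambda>t. H_minus t d \<alpha> \<kappa> \<eta>) at_top (at_left 1)"
    by (rule filterlim_at_top_mono[OF filterlim_tendsto_add_at_top[OF A1 B2]])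
       (use split nonneg in \<open>simp add: add_increasing2\<close>)
qed

lemma K_minus_le_H_minus:
  assumes "d \<ge> 1" "0 < \<alpha>" "\<alpha> < 2" "0 < \<kappa>" "\<kappa> < real d / 2" "0 < \<eta>" "t \<in> {0<..<1}"
  shows "K_minus d \<alpha> \<kappa> \<eta> \<le> H_minus t d \<alpha> \<kappa> \<eta>"
  unfolding K_minus_def using assms
  by (intro Least_coercive_le[of "\<lambda>t. H_minus t d \<alpha> \<kappa> \<eta>"] continuous_on_H_minus H_minus_at_ends)

text \<open>
  The third summand of \<open>H_minus\<close> stays bounded because \<open>2d\<kappa> + (d + \<eta>)\<alpha>\<close>, which is a
  denominator there and the numerator of the base of a power, tends to \<open>2d\<kappa> > 0\<close>.
\<close>

lemma H_minus_at_bot_critical: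
  assumes "d \<ge> 1" "0 < \<kappa>" "\<kappa> < real d / 2" "0 < \<eta>" "0 < t" "t < 1"
  shows "filterlim (\<lambda>\<alpha>. H_minus t d \<alpha> \<kappa> \<eta>) at_bot (at_right 0)"
proof -
  define R where "R \<alpha> = H_minus t d \<alpha> \<kappa> \<eta> + 1 / (\<alpha> * (1 + t) powr \<alpha>)" for \<alpha>
  have R_eq: "R \<alpha> = 1 / ((real d - 2*\<kappa>) * t powr (real d + \<alpha>))
     + (2*\<kappa> * (2*\<kappa> + 1) * real d ^ 2 * t powr (2 - \<alpha>)) / ((2 - \<alpha>) * (1 - t) powr (2*\<kappa> + 2))
     + ((2*\<kappa> * real d + (real d + \<eta>) * \<alpha>) / ((real d + \<eta> - 2*\<kappa>) * \<eta>)) powr (2*\<kappa> / (real d + \<eta>))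
       * ((real d + \<eta> - 2*\<kappa>) / (2 * real d * \<kappa> + (real d + \<eta>) * \<alpha>))
       * (1 / t powr ((2 * real d * \<kappa> + (real d + \<eta>) * \<alpha>) / (real d + \<eta>)))
     - (1 - t) ^ d / (real d * (2 - t) powr (real d + \<alpha>))" for \<alpha>
    by (simp add: R_def H_minus_def)
  have R: "(R \<longlongrightarrow> R 0) (at_right 0)"
    unfolding R_eq by (intro tendsto_intros) (use assms in auto)
  have c: "((\<lambda>\<alpha>. 1 / (1 + t) powr \<alpha>) \<longlongrightarrow> 1 / (1 + t) powr 0) (at_right 0)"
    by (intro tendsto_intros) (use assms in auto)
  have "filterlim (\<lambda>\<alpha>. 1 / (1 + t) powr \<alpha> * inverse \<alpha>) at_top (at_right 0)"
    by (rule filterlim_tendsto_pos_mult_at_top[OF c _ filterlim_inverse_at_top_right])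
       (use assms in auto)
  then have "filterlim (\<lambda>\<alpha>. - R \<alpha> + 1 / (1 + t) powr \<alpha> * inverse \<alpha>) at_top (at_right 0)"
    by (rule filterlim_tendsto_add_at_top[OF tendsto_minus[OF R]])
  then have "filterlim (\<lambda>\<alpha>. - H_minus t d \<alpha> \<kappa> \<eta>) at_top (at_right 0)"
    by (simp add: R_def field_simps)
  then show ?thesis
    by (simp add: filterlim_uminus_at_bot)
qed

section \<open>Signs of the extrema near the critical parameters\<close>

theorem proposition6p1:
  "(\<forall>(d::nat) (\<alpha>::real). 1 \<le> d \<and> 0 < \<alpha> \<and> \<alpha> < 2 \<longrightarrow>
      (\<exists>\<kappa>s::real. (real d - 1) / 2 < \<kappa>s \<and> \<kappa>s < real d / 2 \<and>
         (\<forall>\<kappa>::real. \<kappa>s < \<kappa> \<and> \<kappa> < real d / 2 \<longrightarrow> K_plus d \<alpha> \<kappa> > 0)))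
   \<and>
   (\<forall>(d::nat) (\<eta>::real) (\<kappa>::real). 1 \<le> d \<and> 0 < \<eta> \<and> 0 < \<kappa> \<and> \<kappa> < real d / 2 \<longrightarrow>
      (\<exists>\<alpha>s::real. 0 < \<alpha>s \<and> \<alpha>s < 2 \<and>
         (\<forall>\<alpha>::real. 0 < \<alpha> \<and> \<alpha> < \<alpha>s \<longrightarrow> K_minus d \<alpha> \<kappa> \<eta> < 0)))"
proof (intro conjI allI impI)
  fix d :: nat and \<alpha> :: real
  assume par: "1 \<le> d \<and> 0 < \<alpha> \<and> \<alpha> < 2"
  then have "filterlim (\<lambda>\<kappa>. H_plus d \<alpha> \<kappa> (1/2)) at_top (at_left (real d / 2))"
    by (intro H_plus_at_top_critical) auto
  then have "\<forall>\<^sub>F \<kappa> in at_left (real d / 2). H_plus d \<alpha> \<kappa> (1/2) > 0"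
    by (simp add: filterlim_at_top_dense)
  then obtain b where b: "b < real d / 2"
    "\<And>\<kappa>. b < \<kappa> \<Longrightarrow> \<kappa> < real d / 2 \<Longrightarrow> H_plus d \<alpha> \<kappa> (1/2) > 0"
    by (auto simp: eventually_at_left_field)
  \<comment> \<open>A threshold of at least \<open>d/2 - 1/4\<close> lies strictly above \<open>(d - 1)/2\<close> and is positive.\<close>
  define k where "k = max b (real d / 2 - 1/4)"
  have "K_plus d \<alpha> \<kappa> > 0" if "k < \<kappa>" "\<kappa> < real d / 2" for \<kappa>
    using H_plus_le_K_plus[of d \<alpha> \<kappa> "1/2"] b(2)[of \<kappa>] par that by (simp add: k_def)
  then show "\<exists>\<kappa>s. (real d - 1) / 2 < \<kappa>s \<and> \<kappa>s < real d / 2 \<and>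
      (\<forall>\<kappa>. \<kappa>s < \<kappa> \<and> \<kappa> < real d / 2 \<longrightarrow> K_plus d \<alpha> \<kappa> > 0)"
    using b(1) by (intro exI[of _ k]) (auto simp: k_def max_def)
next
  fix d :: nat and \<eta> \<kappa> :: real
  assume par: "1 \<le> d \<and> 0 < \<eta> \<and> 0 < \<kappa> \<and> \<kappa> < real d / 2"
  then have "filterlim (\<lambda>\<alpha>. H_minus (1/2) d \<alpha> \<kappa> \<eta>) at_bot (at_right 0)"
    by (intro H_minus_at_bot_critical) auto
  then have "\<forall>\<^sub>F \<alpha> in at_right 0. H_minus (1/2) d \<alpha> \<kappa> \<eta> < 0"
    by (simp add: filterlim_at_bot_dense)
  then obtain a where a: "a > 0"
    "\<And>\<alpha>. 0 < \<alpha> \<Longrightarrow> \<alpha> < a \<Longrightarrow> H_minus (1/2) d \<alpha> \<kappa> \<eta> < 0"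
    by (auto simp: eventually_at_right_field)
  have "K_minus d \<alpha> \<kappa> \<eta> < 0" if "0 < \<alpha>" "\<alpha> < min a 1" for \<alpha>
    using K_minus_le_H_minus[of d \<alpha> \<kappa> \<eta> "1/2"] a(2)[of \<alpha>] par that by simp
  then show "\<exists>\<alpha>s. 0 < \<alpha>s \<and> \<alpha>s < 2 \<and>
      (\<forall>\<alpha>. 0 < \<alpha> \<and> \<alpha> < \<alpha>s \<longrightarrow> K_minus d \<alpha> \<kappa> \<eta> < 0)"
    using a(1) by (intro exI[of _ "min a 1"]) auto
qed

end
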